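(* Let $c(G)$ be any chordal extension of $G$. Then $\mathbb V\equiv\mathbb W\equiv\mathbb W_{c(G)}\equiv\mathbb W_G$, where $A\equiv B$ means that there is a bijection between the sets $A$ and $B$.
   Context: $G=(N^+,E)$, $N^+=\{0,\dots,n\}$, is a connected undirected simple graph with a nonzero complex admittance $y_{jk}=y_{kj}$ on each edge. For complex numbers, $a\le b$ means inequality of both real and imaginary parts. Given are bounds $\underline v_j\le\overline v_j$ with $\underline v_j>0$ and complex bounds $\underline s_j,\overline s_j$ (possibly infinite), $j\in N^+$; for the slack bus $\underline v_0=\overline v_0=1$ and the bounds on $s_0$ are infinite (no constraint). $\mathbb V$ (the feasible set of optimal power flow in the bus injection model) is the set of $V\in\mathbb C^{n+1}$ with $V_0=1$ such that for all $j\in N^+$: $\underline v_j\le|V_j|^2\le\overline v_j$ and $\underline s_j\le\sum_{k:(j,k)\in E}y_{jk}^HV_j(V_j^H-V_k^H)\le\overline s_j$. Partial matrices: for an undirected graph $F$ on $N^+$, a partial matrix $W_F$ is a collection of complex numbers $[W_F]_{jj}$ (nodes) and $[W_F]_{jk},[W_F]_{kj}$ (edges of $F$). The submatrix on $F$ of a (partial) matrix is the collection of its entries on nodes and edges of $F$; $W_F(q)$ is the principal submatrix on a clique $q$ of $F$ (for an edge, the $2\times2$ matrix $W_F(j,k)$). $W_F\succeq0$ means $W_F$ is Hermitian and $W_F(q)\succeq0$ for all cliques $q$ of $F$; $\operatorname{rank}W_F=1$ means $\operatorname{rank}W_F(q)=1$ for all cliques $q$. A graph is chordal if all its chordless cycles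 have length three (or it has no cycle); a chordal extension $c(G)$ of $G$ is a chordal graph on the same nodes containing all edges of $G$. Operational constraints (OC) on a (partial) matrix with submatrix $W_G$ on $G$: for all $j\in N^+$, $\underline s_j\le\sum_{k:(j,k)\in E}y_{jk}^H([W_G]_{jj}-[W_G]_{jk})\le\overline s_j$ and $\underline v_j\le[W_G]_{jj}\le\overline v_j$. Cycle condition on $W_G$: for every cycle $c$ of $G$, $\sum_{(j,k)\in c}\angle[W_G]_{jk}=0\mod 2\pi$, edges traversed in the direction of the cycle. Sets: $\mathbb W$ is the set of Hermitian $(n+1)\times(n+1)$ matrices $W$ satisfying (OC), $W\succeq0$, $\operatorname{rank}W=1$. $\mathbb W_{c(G)}$ is the set of partial matrices $W_{c(G)}$ on $c(G)$ satisfying (OC), $W_{c(G)}\succeq0$, $\operatorname{rank}W_{c(G)}=1$. $\mathbb W_G$ is the set of Hermitian partial matrices $W_G$ on $G$ satisfying (OC), the cycle condition, and $W_G(j,k)\succeq0$, $\operatorname{rank}W_G(j,k)=1$ for all $(j,k)\in E$. *)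

theory Defs
  imports
    "HOL-Analysis.Analysis"
    "HOL-Library.Real_Mod"
    "HOL-Library.Equipollence"
    "HOL-Library.FuncSet"
    "Graph_Theory.Graph_Theory"
    "Jordan_Normal_Form.Schur_Decomposition"
    "Jordan_Normal_Form.DL_Rank"
    "Jordan_Normal_Form.DL_Submatrix"
begin

section \<open>Undirected simple graphs\<close>

text \<open>
  An undirected simple graph is a \<^locale>\<open>pair_graph\<close>: a finite, loop-free
  digraph whose set of arcs is symmetric, each edge being represented by both of its
  orientations. In such a digraph the traversal of one edge back and forth is a
  \<^const>\<open>pre_digraph.cycle\<close>; cycles of the undirected graph are those of length at least
  three. A cycle is a list of arcs oriented in the direction of traversal.
\<close>

definition ucycle :: "'a pair_pre_digraph \<Rightarrow> ('a \<times> 'a) list \<Rightarrow> bool" where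
  "ucycle F c \<longleftrightarrow> pre_digraph.cycle (with_proj F) c \<and> 3 \<le> length c"

definition is_chord :: "'a pair_pre_digraph \<Rightarrow> ('a \<times> 'a) list \<Rightarrow> 'a \<times> 'a \<Rightarrow> bool" where
  "is_chord F c e \<longleftrightarrow>
     e \<in> parcs F \<and> fst e \<in> fst ` set c \<and> snd e \<in> fst ` set c \<and>
     e \<notin> set c \<and> prod.swap e \<notin> set c"

definition chordal :: "'a pair_pre_digraph \<Rightarrow> bool" where
  "chordal F \<longleftrightarrow> (\<forall>c. ucycle F c \<and> (\<nexists>e. is_chord F c e) \<longrightarrow> length c = 3)"

definition chordal_extension :: "'a pair_pre_digraph \<Rightarrow> 'a pair_pre_digraph \<Rightarrow> bool" where
  "chordal_extension F G \<longleftrightarrow>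
     pair_graph F \<and> pverts F = pverts G \<and> parcs G \<subseteq> parcs F \<and> chordal F"

text \<open>Cliques are nonempty; the empty principal submatrix would have rank zero.\<close>

definition clique :: "'a pair_pre_digraph \<Rightarrow> 'a set \<Rightarrow> bool" where
  "clique F q \<longleftrightarrow>
     q \<noteq> {} \<and> q \<subseteq> pverts F \<and> (\<forall>j\<in>q. \<forall>k\<in>q. j \<noteq> k \<longrightarrow> (j, k) \<in> parcs F)"


section \<open>Matrices and partial matrices\<close>

definition hermitian_mat :: "complex mat \<Rightarrow> bool" where
  "hermitian_mat A \<longleftrightarrow> mat_adjoint A = A"

text \<open>Here \<open>(A *\<^sub>v x) \<bullet>c x\<close> is $x^H A x$, a real number for Hermitian \<open>A\<close>.\<close>

definition psd_mat :: "complex mat \<Rightarrow> bool" where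
  "psd_mat A \<longleftrightarrow> hermitian_mat A \<and>
     (\<forall>x \<in> carrier_vec (dim_col A). 0 \<le> Re ((A *\<^sub>v x) \<bullet>c x))"

definition mat_rank :: "complex mat \<Rightarrow> nat" where
  "mat_rank A = vec_space.rank (dim_row A) A"

text \<open>
  A partial matrix on \<open>F\<close> is a function that is \<^term>\<open>undefined\<close> off the index set of \<open>F\<close>, so
  that two partial matrices are equal iff all their entries on nodes and edges agree.
\<close>

type_synonym pmat = "nat \<times> nat \<Rightarrow> complex"

definition pm_index :: "nat pair_pre_digraph \<Rightarrow> (nat \<times> nat) set" where
  "pm_index F = {(j, j) | j. j \<in> pverts F} \<union> parcs F"

definition partial_mats :: "nat pair_pre_digraph \<Rightarrow> pmat set" where
  "partial_mats F = extensional (pm_index F)"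

definition submat_on :: "nat pair_pre_digraph \<Rightarrow> pmat \<Rightarrow> pmat" where
  "submat_on F W = restrict W (pm_index F)"

definition full_submat_on :: "nat pair_pre_digraph \<Rightarrow> complex mat \<Rightarrow> pmat" where
  "full_submat_on F W = restrict (\<lambda>(j, k). W $$ (j, k)) (pm_index F)"

text \<open>\<^term>\<open>pick q i\<close> is the \<open>i\<close>-th smallest element of \<open>q\<close>, counting from zero.\<close>

definition principal_submat :: "pmat \<Rightarrow> nat set \<Rightarrow> complex mat" where
  "principal_submat W q = mat (card q) (card q) (\<lambda>(a, b). W (pick q a, pick q b))"

definition pm_hermitian :: "nat pair_pre_digraph \<Rightarrow> pmat \<Rightarrow> bool" where
  "pm_hermitian F W \<longleftrightarrow> (\<forall>(j, k) \<in> pm_index F. W (k, j) = cnj (W (j, k)))"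

definition pm_psd :: "nat pair_pre_digraph \<Rightarrow> pmat \<Rightarrow> bool" where
  "pm_psd F W \<longleftrightarrow> pm_hermitian F W \<and> (\<forall>q. clique F q \<longrightarrow> psd_mat (principal_submat W q))"

definition pm_rank1 :: "nat pair_pre_digraph \<Rightarrow> pmat \<Rightarrow> bool" where
  "pm_rank1 F W \<longleftrightarrow> (\<forall>q. clique F q \<longrightarrow> mat_rank (principal_submat W q) = 1)"


section \<open>Optimal power flow constraints\<close>

text \<open>
  A complex bound is the pair of its real and imaginary part, each possibly infinite. Note that
  the library order on \<^typ>\<open>complex\<close> requires equal imaginary parts and is not the one
  used here.
\<close>

type_synonym cbound = "ereal \<times> ereal"

definition cbetween :: "cbound \<Rightarrow> complex \<Rightarrow> cbound \<Rightarrow> bool" where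
  "cbetween l z u \<longleftrightarrow>
     fst l \<le> ereal (Re z) \<and> ereal (Re z) \<le> fst u \<and>
     snd l \<le> ereal (Im z) \<and> ereal (Im z) \<le> snd u"

definition bim_feasible ::
  "nat \<Rightarrow> nat pair_pre_digraph \<Rightarrow> (nat \<Rightarrow> nat \<Rightarrow> complex) \<Rightarrow> (nat \<Rightarrow> real) \<Rightarrow> (nat \<Rightarrow> real) \<Rightarrow>
   (nat \<Rightarrow> cbound) \<Rightarrow> (nat \<Rightarrow> cbound) \<Rightarrow> complex vec set" where
  "bim_feasible n G y vl vu sl su =
     {V \<in> carrier_vec (n + 1). V $ 0 = 1 \<and>
        (\<forall>j \<in> {0..n}.
           vl j \<le> (cmod (V $ j))\<^sup>2 \<and> (cmod (V $ j))\<^sup>2 \<le> vu j \<and>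
           cbetween (sl j)
             (\<Sum>k | (j, k) \<in> parcs G. cnj (y j k) * (V $ j) * (cnj (V $ j) - cnj (V $ k)))
             (su j))}"

text \<open>\<open>W\<close> is the submatrix on \<open>G\<close> of the (partial) matrix under consideration.\<close>

definition oper_constraints ::
  "nat \<Rightarrow> nat pair_pre_digraph \<Rightarrow> (nat \<Rightarrow> nat \<Rightarrow> complex) \<Rightarrow> (nat \<Rightarrow> real) \<Rightarrow> (nat \<Rightarrow> real) \<Rightarrow>
   (nat \<Rightarrow> cbound) \<Rightarrow> (nat \<Rightarrow> cbound) \<Rightarrow> pmat \<Rightarrow> bool" where
  "oper_constraints n G y vl vu sl su W \<longleftrightarrow>
     (\<forall>j \<in> {0..n}.
        cbetween (sl j) (\<Sum>k | (j, k) \<in> parcs G. cnj (y j k) * (W (j, j) - W (j, k))) (su j) \<and>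
        cbetween (ereal (vl j), 0) (W (j, j)) (ereal (vu j), 0))"

definition cycle_condition :: "nat pair_pre_digraph \<Rightarrow> pmat \<Rightarrow> bool" where
  "cycle_condition G W \<longleftrightarrow>
     (\<forall>c. ucycle G c \<longrightarrow> [(\<Sum>e\<leftarrow>c. Arg (W e)) = 0] (rmod (2 * pi)))"

definition full_feasible ::
  "nat \<Rightarrow> nat pair_pre_digraph \<Rightarrow> (nat \<Rightarrow> nat \<Rightarrow> complex) \<Rightarrow> (nat \<Rightarrow> real) \<Rightarrow> (nat \<Rightarrow> real) \<Rightarrow>
   (nat \<Rightarrow> cbound) \<Rightarrow> (nat \<Rightarrow> cbound) \<Rightarrow> complex mat set" where
  "full_feasible n G y vl vu sl su =
     {W \<in> carrier_mat (n + 1) (n + 1).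
        hermitian_mat W \<and>
        oper_constraints n G y vl vu sl su (full_submat_on G W) \<and>
        psd_mat W \<and> mat_rank W = 1}"

definition chordal_feasible ::
  "nat \<Rightarrow> nat pair_pre_digraph \<Rightarrow> nat pair_pre_digraph \<Rightarrow> (nat \<Rightarrow> nat \<Rightarrow> complex) \<Rightarrow>
   (nat \<Rightarrow> real) \<Rightarrow> (nat \<Rightarrow> real) \<Rightarrow> (nat \<Rightarrow> cbound) \<Rightarrow> (nat \<Rightarrow> cbound) \<Rightarrow> pmat set" where
  "chordal_feasible n G F y vl vu sl su =
     {W \<in> partial_mats F.
        oper_constraints n G y vl vu sl su (submat_on G W) \<and> pm_psd F W \<and> pm_rank1 F W}"

definition network_feasible ::
  "nat \<Rightarrow> nat pair_pre_digraph \<Rightarrow> (nat \<Rightarrow> nat \<Rightarrow> complex) \<Rightarrow> (nat \<Rightarrow> real) \<Rightarrow> (nat \<Rightarrow> real) \<Rightarrow>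
   (nat \<Rightarrow> cbound) \<Rightarrow> (nat \<Rightarrow> cbound) \<Rightarrow> pmat set" where
  "network_feasible n G y vl vu sl su =
     {W \<in> partial_mats G.
        pm_hermitian G W \<and>
        oper_constraints n G y vl vu sl su W \<and>
        cycle_condition G W \<and>
        (\<forall>(j, k) \<in> parcs G.
           psd_mat (principal_submat W {j, k}) \<and> mat_rank (principal_submat W {j, k}) = 1)}"

end

theory Submission
  imports Defs
begin

text \<open>
  In each of the three cases the bijection sends \<open>V\<close> to the (partial) matrix with entries
  $V_j V_k^H$. It is injective because \<open>G\<close> is connected and $V_0 = 1$: the voltages are
  recovered one after the other along a walk to the slack bus. For surjectivity one has to factor
  a (partial) matrix. A full matrix is factored by its column $0$. For a partial matrix, the moduli
  on edges are $\sqrt{W_{jj} W_{kk}}$ by the rank condition, so only the phases $W_{jk} / |W_{jk}|$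
  have to be written as quotients of a potential on the nodes, which is possible iff their product
  along every closed walk is one. It suffices to know this for chordless cycles. On \<open>G\<close> it is the
  cycle condition; on a chordal graph the chordless cycles are triangles, where it is a vanishing
  $2 \times 2$ minor of a clique of size three.
\<close>

unbundle no vec_syntax


section \<open>Gain functions on the arcs of a graph\<close>

context pair_graph
begin

text \<open>
  Strong induction on the length: a closed walk that is not a chordless cycle splits into two
  shorter closed walks, at a repeated vertex or along a chord, which is traversed once in each
  direction.
\<close>

lemma closed_walk_gain:
  fixes g :: "'a \<times> 'a \<Rightarrow> 'b::comm_monoid_mult"
  assumes inv: "\<And>u v. (u, v) \<in> parcs G \<Longrightarrow> g (u, v) * g (v, u) = 1"
    and cyc: "\<And>c. ucycle G c \<Longrightarrow> \<nexists>e. is_chord G c e \<Longrightarrow> prod_list (map g c) = 1"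
    and walk: "awalk u p u"
  shows "prod_list (map g p) = 1"
  using walk
proof (induction "length p" arbitrary: u p rule: less_induct)
  case less
  show ?case
  proof (cases p)
    case Nil
    then show ?thesis by simp
  next
    case (Cons e es)
    have es: "awalk (snd e) es u" and e: "e \<in> parcs G" "fst e = u"
      using less.prems Cons by (auto simp: awalk_Cons_iff)
    show ?thesis
    proof (cases "distinct (awalk_verts (snd e) es)")
      case False
      obtain q r s w where d: "es = q @ r @ s" "0 < length r"
        "awalk (snd e) q w" "awalk w r w" "awalk w s u"
        using awalk_not_distinct_decomp[OF es False] by blast
      have "awalk u (e # q @ s) u"
        using awalk_appendI[OF d(3,5)] e by (simp add: awalk_Cons_iff del: awalk_append_iff)
      then have "prod_list (map g (e # q @ s)) = 1"
        using d Cons by (intro less.hyps) auto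
      moreover have "prod_list (map g r) = 1"
        using d Cons e by (intro less.hyps) auto
      ultimately show ?thesis
        using Cons d by (simp add: ac_simps)
    next
      case True
      then have cycle: "cycle p"
        unfolding cycle_def using less.prems Cons by auto
      \<comment> \<open>Without loops a nonempty closed walk has at least two arcs. With exactly two
        it runs back and forth along an edge; this is not a \<open>ucycle\<close> and is covered by
        \<open>inv\<close>.\<close>
      have "es \<noteq> []"
        using es e(2) pair_no_loops[OF e(1)] by (auto simp: awalk_Nil_iff)
      then obtain f fs where fs: "es = f # fs" by (cases es) auto
      show ?thesis
      proof (cases "fs = []")
        case True
        then have "p = [(u, fst f), (fst f, u)]"
          using Cons fs es e by (cases e; cases f) (auto simp: awalk_simps)
        then show ?thesis using e Cons inv by auto
      next
        case False
        then have "ucycle G p"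
          using cycle Cons fs by (cases fs) (auto simp: ucycle_def)
        show ?thesis
        proof (cases "\<exists>e. is_chord G p e")
          case False
          with \<open>ucycle G p\<close> show ?thesis by (intro cyc)
        next
          case True
          then obtain a b where ab: "(a, b) \<in> parcs G" "a \<in> fst ` set p" "b \<in> fst ` set p"
            "(a, b) \<notin> set p" "(b, a) \<notin> set p"
            unfolding is_chord_def by (metis prod.collapse prod.swap_def)
          have "a \<in> set (awalk_verts u p)"
            using ab by (auto simp: set_awalk_verts[OF less.prems])
          then obtain q r where qr: "p = q @ r" "awalk u q a" "awalk a r u"
            using awalk_decomp[OF less.prems] by blast
          \<comment> \<open>The closed walk is rotated to start at \<open>a\<close>, so that one cut
            at \<open>b\<close> separates the two sides of the chord. By commutativity the rotation
            does not change the product.\<close>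
          have rq: "awalk a (r @ q) a" using qr by (intro awalk_appendI)
          moreover have "b \<in> set (awalk_verts a (r @ q))"
            using ab qr by (auto simp: set_awalk_verts[OF rq])
          ultimately obtain p1 p2 where p12: "r @ q = p1 @ p2" "awalk a p1 b" "awalk b p2 a"
            using awalk_decomp by blast
          have sub: "set p1 \<subseteq> set p" "set p2 \<subseteq> set p"
            using p12(1) qr(1) by (metis Un_commute Un_upper1 Un_upper2 set_append)+
          have len: "length p = length p1 + length p2"
            using p12(1) qr(1) by (metis add.commute length_append)
          have "a \<noteq> b" using ab no_loops' by blast
          \<comment> \<open>Each side of the chord has at least two arcs, so trading one side for
            the single arc of the chord shortens the walk, as the induction requires.\<close>
          have long: "2 \<le> length c"
            if "awalk x c y" "x \<noteq> y" "(x, y) \<notin> set c" for x y c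
          proof (cases c)
            case (Cons z zs)
            then show ?thesis using that by (cases zs; cases z) (auto simp: awalk_simps)
          qed (use that in \<open>auto simp: awalk_simps\<close>)
          have l1: "2 \<le> length p1" and l2: "2 \<le> length p2"
            using long[OF p12(2)] long[OF p12(3)] \<open>a \<noteq> b\<close> ab sub by auto
          have ba: "(b, a) \<in> parcs G" using ab arcs_symmetric by blast
          have "awalk a (p1 @ [(b, a)]) a" "awalk b (p2 @ [(a, b)]) b"
            using awalk_appendI[OF p12(2) arc_implies_awalk[OF ba, simplified]]
              awalk_appendI[OF p12(3) arc_implies_awalk[OF ab(1), simplified]] by simp_all
          then have "prod_list (map g (p1 @ [(b, a)])) = 1" "prod_list (map g (p2 @ [(a, b)])) = 1"
            using len l1 l2 by (auto intro!: less.hyps simp del: awalk_append_iff map_append)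
          then have "(prod_list (map g p1) * g (b, a)) * (prod_list (map g p2) * g (a, b)) = 1"
            by simp
          then have "prod_list (map g p1) * prod_list (map g p2) * (g (a, b) * g (b, a)) = 1"
            by (simp add: ac_simps)
          then have "prod_list (map g (p1 @ p2)) = 1"
            using inv[OF ab(1)] by simp
          then show ?thesis
            unfolding p12(1)[symmetric] qr(1) by (simp add: mult.commute)
        qed
      qed
    qed
  qed
qed

text \<open>The potential at \<open>u\<close> is the product of the gains along a chosen walk from
  \<open>u\<close> to the root. The arc from \<open>u\<close> to \<open>v\<close>, the walk of
  \<open>v\<close> and the reversed walk of \<open>u\<close> close up, so their product is one, and
  the reversed walk contributes the inverse of its gain. The chosen walk at the root is itself
  closed, whence \<open>\<phi> r = 1\<close>.\<close>

lemma gain_potential: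
  fixes g :: "'a \<times> 'a \<Rightarrow> complex"
  assumes unit: "\<And>e. e \<in> parcs G \<Longrightarrow> norm (g e) = 1"
    and inv: "\<And>u v. (u, v) \<in> parcs G \<Longrightarrow> g (v, u) = cnj (g (u, v))"
    and cyc: "\<And>c. ucycle G c \<Longrightarrow> \<nexists>e. is_chord G c e \<Longrightarrow> prod_list (map g c) = 1"
    and walks: "\<And>u. u \<in> pverts G \<Longrightarrow> \<exists>p. awalk u p r"
    and root: "r \<in> pverts G"
  obtains \<phi> where "\<phi> r = 1" "\<And>u. u \<in> pverts G \<Longrightarrow> norm (\<phi> u) = 1"
    "\<And>u v. (u, v) \<in> parcs G \<Longrightarrow> g (u, v) = \<phi> u * cnj (\<phi> v)"
proof -
  have inv': "g (u, v) * g (v, u) = 1" if "(u, v) \<in> parcs G" for u v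
    using unit[OF that] inv[OF that] by (simp add: complex_norm_square[symmetric])
  have closed: "prod_list (map g p) = 1" if "awalk u p u" for u p
    using closed_walk_gain[of g, OF inv' cyc that] by blast
  define w where "w u = (SOME p. awalk u p r)" for u
  have w: "awalk u (w u) r" if "u \<in> pverts G" for u
    unfolding w_def using walks[OF that] by (rule someI_ex)
  define \<phi> where "\<phi> u = prod_list (map g (w u))" for u
  have norm_prod: "norm (prod_list (map g p)) = 1" if "set p \<subseteq> parcs G" for p
    using that by (induction p) (auto simp: norm_mult unit)
  have unit_\<phi>: "norm (\<phi> u) = 1" if "u \<in> pverts G" for u
    unfolding \<phi>_def using w[OF that] by (intro norm_prod) auto
  have rev: "prod_list (map g (rev_path p)) * prod_list (map g p) = 1" if "set p \<subseteq> parcs G" for p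
    using that
  proof (induction p)
    case (Cons e p)
    then have e: "g (snd e, fst e) * g e = 1"
      using inv'[of "fst e" "snd e"] by (simp add: mult.commute)
    have "prod_list (map g (rev_path (e # p))) * prod_list (map g (e # p))
       = (g (snd e, fst e) * g e) * (prod_list (map g (rev_path p)) * prod_list (map g p))"
      by (simp add: ac_simps)
    moreover have "prod_list (map g (rev_path p)) * prod_list (map g p) = 1"
      using Cons by simp
    ultimately show ?case unfolding e by (simp only: mult_1)
  qed simp
  have "g (u, v) = \<phi> u * cnj (\<phi> v)" if uv: "(u, v) \<in> parcs G" for u v
  proof -
    have u: "u \<in> pverts G" and v: "v \<in> pverts G" using uv wellformed' by auto
    have "awalk u ((u, v) # w v @ rev_path (w u)) u"
      using awalk_appendI[OF w[OF v]] w[OF u] uv by (simp add: awalk_Cons_iff del: awalk_append_iff)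
    from closed[OF this] have "g (u, v) * \<phi> v * prod_list (map g (rev_path (w u))) = 1"
      by (simp add: \<phi>_def mult.assoc)
    moreover have "prod_list (map g (rev_path (w u))) * \<phi> u = 1"
      unfolding \<phi>_def using w[OF u] by (intro rev) (auto elim: awalkE')
    ultimately have "g (u, v) * \<phi> v = \<phi> u"
      by (metis mult.assoc mult.right_neutral mult.left_neutral)
    then have "\<phi> u * cnj (\<phi> v) = g (u, v) * (\<phi> v * cnj (\<phi> v))" by simp
    then show ?thesis
      using unit_\<phi>[OF v] by (simp add: complex_norm_square[symmetric])
  qed
  moreover have "\<phi> r = 1" unfolding \<phi>_def using closed w[OF root] by blast
  ultimately show thesis using unit_\<phi> that by blast
qed

text \<open>Neighbouring factors cancel by \<open>unit\<close>, so on a closed walk the product is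
  one. With the voltage phases for \<open>f\<close> this yields the cycle condition.\<close>

lemma prod_telescope:
  fixes f :: "'a \<Rightarrow> complex"
  assumes unit: "\<And>j. j \<in> pverts G \<Longrightarrow> f j * cnj (f j) = 1" and "awalk j p k"
  shows "prod_list (map (\<lambda>e. f (fst e) * cnj (f (snd e))) p) = f j * cnj (f k)"
  using assms(2)
proof (induction p arbitrary: j)
  case Nil
  then show ?case using unit by (auto simp: awalk_Nil_iff)
next
  case (Cons e p)
  then have e: "snd e \<in> pverts G" "j = fst e" "awalk (snd e) p k"
    by (auto simp: awalk_Cons_iff)
  have "prod_list (map (\<lambda>e. f (fst e) * cnj (f (snd e))) (e # p)) =
      f j * (f (snd e) * cnj (f (snd e))) * cnj (f k)"
    using Cons.IH[OF e(3)] e(2) by (simp add: mult_ac)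
  then show ?case using unit[OF e(1)] by simp
qed

end

section \<open>Phases and arguments of complex numbers\<close>

lemma sgn_cnj: "sgn (cnj z) = cnj (sgn z)"
  by (simp add: sgn_eq)

text \<open>Passes between the argument sums of \<open>cycle_condition\<close> and multiplicative
  gains. The values must be nonzero because \<open>sgn 0 = 0\<close>, whereas an argument of zero
  would contribute the factor one.\<close>

lemma prod_list_sgn_eq_1_iff:
  fixes f :: "'a \<Rightarrow> complex"
  assumes "\<And>x. x \<in> set xs \<Longrightarrow> f x \<noteq> 0"
  shows "prod_list (map (\<lambda>x. sgn (f x)) xs) = 1 \<longleftrightarrow> [(\<Sum>x\<leftarrow>xs. Arg (f x)) = 0] (rmod (2 * pi))"
proof -
  have "prod_list (map (\<lambda>x. sgn (f x)) xs) = cis (\<Sum>x\<leftarrow>xs. Arg (f x))"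
    using assms by (induction xs) (auto simp: cis_Arg cis_mult[symmetric])
  then show ?thesis using cis_eq_iff[of _ 0] by simp
qed


section \<open>Matrices of rank one\<close>

lemma rank_1_minor:
  assumes A: "A \<in> carrier_mat nr nc" and r: "mat_rank A = 1"
    and ij: "i < nr" "j < nr" and kl: "k < nc" "l < nc"
  shows "A $$ (i, k) * A $$ (j, l) = A $$ (i, l) * A $$ (j, k)"
proof (cases "col A k = col A l")
  \<comment> \<open>Equal columns are treated apart: as a set they have only one element, so the
    bound of the rank by a cardinality would give no contradiction.\<close>
  case True
  then have "A $$ (i, k) = A $$ (i, l)" "A $$ (j, k) = A $$ (j, l)"
    using A ij kl by (metis carrier_matD index_col)+
  then show ?thesis by simp
next
  case False
  interpret vec_space "TYPE(complex)" nr .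
  \<comment> \<open>A rank-one matrix has no two independent columns, so its columns $k$ and $l$ satisfy a
    nontrivial linear relation \<open>v\<close>.\<close>
  define B where "B = mat_of_cols nr [col A k, col A l]"
  have B: "B \<in> carrier_mat nr 2" unfolding B_def by (auto simp: mat_of_cols_def numeral_2_eq_2)
  have cB: "cols B = [col A k, col A l]"
    unfolding B_def using A by (intro cols_mat_of_cols) auto
  have "lin_dep (set (cols B))"
  proof (rule ccontr)
    assume "lin_indpt (set (cols B))"
    moreover have "set (cols B) \<subseteq> set (cols A)"
      using A kl unfolding cB by (auto simp: cols_def)
    ultimately have "card (set (cols B)) \<le> rank A"
      using rank_ge_card_indpt[OF A] by blast
    then show False using r A False by (simp add: cB mat_rank_def)
  qed
  then obtain v where v: "v \<in> carrier_vec 2" "v \<noteq> 0\<^sub>v 2" "B *\<^sub>v v = 0\<^sub>v nr"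
    using lin_depE[OF B] False cB by auto
  have eq: "A $$ (m, k) * v $ 0 + A $$ (m, l) * v $ 1 = 0" if m: "m < nr" for m
  proof -
    have "(B *\<^sub>v v) $ m = 0" using v m by simp
    moreover have "row B m = vec 2 (\<lambda>c. [A $$ (m, k), A $$ (m, l)] ! c)"
      using m A kl B by (intro eq_vecI) (auto simp: B_def mat_of_cols_def less_2_cases_iff)
    ultimately show ?thesis
      using m B v(1) by (simp add: scalar_prod_def numeral_2_eq_2)
  qed
  have "v $ 0 \<noteq> 0 \<or> v $ 1 \<noteq> 0"
    using v(1,2) by (auto simp: Matrix.vec_eq_iff less_2_cases_iff)
  \<comment> \<open>The minor times either coefficient of \<open>v\<close> is a combination of the
    relations in rows \<open>i\<close> and \<open>j\<close>, hence zero, and one of the coefficients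
    is nonzero.\<close>
  moreover have "v $ 0 * (A $$ (i, k) * A $$ (j, l) - A $$ (i, l) * A $$ (j, k)) =
      A $$ (j, l) * (A $$ (i, k) * v $ 0 + A $$ (i, l) * v $ 1)
      - A $$ (i, l) * (A $$ (j, k) * v $ 0 + A $$ (j, l) * v $ 1)"
    "v $ 1 * (A $$ (i, k) * A $$ (j, l) - A $$ (i, l) * A $$ (j, k)) =
      A $$ (i, k) * (A $$ (j, k) * v $ 0 + A $$ (j, l) * v $ 1)
      - A $$ (j, k) * (A $$ (i, k) * v $ 0 + A $$ (i, l) * v $ 1)"
    by (simp_all add: algebra_simps)
  ultimately show ?thesis using eq[OF ij(1)] eq[OF ij(2)] by auto
qed

section \<open>Outer products\<close>

definition outer_mat :: "nat \<Rightarrow> (nat \<Rightarrow> complex) \<Rightarrow> complex mat" where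
  "outer_mat m v = mat m m (\<lambda>(i, j). v i * cnj (v j))"

lemma outer_mat_carrier [simp]: "outer_mat m v \<in> carrier_mat m m"
  by (simp add: outer_mat_def)

lemma outer_mat_index [simp]:
  "i < m \<Longrightarrow> j < m \<Longrightarrow> outer_mat m v $$ (i, j) = v i * cnj (v j)"
  by (simp add: outer_mat_def)

lemma hermitian_mat_iff:
  assumes "A \<in> carrier_mat m m"
  shows "hermitian_mat A \<longleftrightarrow> (\<forall>i<m. \<forall>j<m. A $$ (j, i) = cnj (A $$ (i, j)))"
proof -
  have "mat_adjoint A \<in> carrier_mat m m"
    using assms by (auto simp: mat_adjoint_def mat_of_rows_def)
  moreover have "mat_adjoint A $$ (j, i) = cnj (A $$ (i, j))" if "i < m" "j < m" for i j
    using that assms by (simp add: mat_adjoint_def mat_of_rows_def)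
  ultimately show ?thesis
    using assms unfolding hermitian_mat_def by (metis carrier_matD eq_matI)
qed

text \<open>With s the sum of all \<open>v i * cnj (x $ i)\<close>, the quadratic form at
  \<open>x\<close> is s times its conjugate, a squared modulus.\<close>

lemma psd_outer_mat: "psd_mat (outer_mat m v)"
proof -
  have "0 \<le> Re ((outer_mat m v *\<^sub>v x) \<bullet>c x)" if x: "x \<in> carrier_vec m" for x
  proof -
    let ?s = "\<Sum>i<m. v i * cnj (x $ i)"
    have "(outer_mat m v *\<^sub>v x) $ i = v i * cnj ?s" if "i < m" for i
      using that x
      by (simp add: scalar_prod_def outer_mat_def atLeast0LessThan sum_distrib_left mult_ac)
    then have "(outer_mat m v *\<^sub>v x) \<bullet>c x = (\<Sum>i<m. v i * cnj ?s * cnj (x $ i))"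
      using x by (simp add: scalar_prod_def atLeast0LessThan)
    also have "\<dots> = ?s * cnj ?s"
      by (subst sum_distrib_right) (simp add: mult_ac)
    also have "\<dots> = complex_of_real ((cmod ?s)\<^sup>2)"
      by (rule complex_norm_square[symmetric])
    finally show ?thesis by simp
  qed
  then show ?thesis
    by (auto simp: psd_mat_def hermitian_mat_iff[of _ m]) (simp add: outer_mat_def)
qed

text \<open>Column \<open>i\<close> has the squared modulus of \<open>v i\<close> at position
  \<open>i\<close>, so it is nonzero and the rank is at least one. Entries that split into a row
  factor and a column factor give rank at most one.\<close>

lemma rank_outer_mat:
  assumes "i < m" "v i \<noteq> 0"
  shows "mat_rank (outer_mat m v) = 1"
proof -
  interpret vec_space "TYPE(complex)" m .
  let ?A = "outer_mat m v"
  have c: "col ?A i \<in> carrier_vec m" "col ?A i \<in> set (cols ?A)"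
    using assms by (auto simp: cols_def outer_mat_def)
  have "col ?A i $ i \<noteq> 0" using assms by (simp add: outer_mat_def)
  then have "col ?A i \<noteq> 0\<^sub>v m" using assms by force
  then have "lin_indpt {col ?A i}" using c(1) by (subst lindep_span) (auto simp: span_empty)
  then have "1 \<le> rank ?A"
    using rank_ge_card_indpt[of ?A m "{col ?A i}"] c by simp
  moreover have "rank ?A \<le> 1"
    by (rule rank_le_1_product_entries[of _ m v "\<lambda>j. cnj (v j)"]) (auto simp: outer_mat_def)
  ultimately show ?thesis by (simp add: mat_rank_def outer_mat_def)
qed

section \<open>Principal submatrices of partial matrices\<close>

lemma principal_submat_outer:
  assumes "\<And>j k. j \<in> q \<Longrightarrow> k \<in> q \<Longrightarrow> W (j, k) = v j * cnj (v k)"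
  shows "principal_submat W q = outer_mat (card q) (v \<circ> pick q)"
  unfolding principal_submat_def outer_mat_def
  using assms by (intro eq_matI) (auto simp: pick_in_set_le)

lemma principal_submat_outer_psd_rank_1:
  assumes "finite q" "q \<noteq> {}" "\<And>j. j \<in> q \<Longrightarrow> v j \<noteq> 0"
    and "\<And>j k. j \<in> q \<Longrightarrow> k \<in> q \<Longrightarrow> W (j, k) = v j * cnj (v k)"
  shows "psd_mat (principal_submat W q)" "mat_rank (principal_submat W q) = 1"
proof -
  have "0 < card q" using assms by (simp add: card_gt_0_iff)
  moreover from this have "v (pick q 0) \<noteq> 0"
    using assms(3) pick_in_set_le by blast
  moreover have "principal_submat W q = outer_mat (card q) (v \<circ> pick q)"
    using assms(4) by (rule principal_submat_outer)
  ultimately show "psd_mat (principal_submat W q)" "mat_rank (principal_submat W q) = 1"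
    by (simp_all add: psd_outer_mat rank_outer_mat[of 0] del: pick.simps)
qed

text \<open>Carries the vanishing minors from positions to node labels. The nodes may coincide, so
  that diagonal entries can enter.\<close>

lemma principal_submat_rank_1_minor:
  assumes q: "finite q" and r: "mat_rank (principal_submat W q) = 1"
    and "i \<in> q" "j \<in> q" "k \<in> q" "l \<in> q"
  shows "W (i, k) * W (j, l) = W (i, l) * W (j, k)"
proof -
  \<comment> \<open>The position of a node in the increasing enumeration of \<open>q\<close> is the
    number of smaller nodes in \<open>q\<close>.\<close>
  have pos: "\<exists>a<card q. pick q a = i" if "i \<in> q" for i
  proof (intro exI conjI)
    show "pick q (card {a\<in>q. a < i}) = i" using that by (rule pick_card_in_set)
    show "card {a\<in>q. a < i} < card q" using that q by (intro psubset_card_mono) auto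
  qed
  obtain a b c d where "a < card q" "b < card q" "c < card q" "d < card q"
    "pick q a = i" "pick q b = j" "pick q c = k" "pick q d = l"
    using assms pos by metis
  then show ?thesis
    using rank_1_minor[of "principal_submat W q" "card q" "card q" a b c d] r
    by (auto simp: principal_submat_def)
qed


section \<open>Factorization of feasible matrices\<close>

locale opf =
  fixes n :: nat
    and G :: "nat pair_pre_digraph"
    and y :: "nat \<Rightarrow> nat \<Rightarrow> complex"
    and vl vu :: "nat \<Rightarrow> real"
    and sl su :: "nat \<Rightarrow> cbound"
  assumes graph: "pair_graph G"
    and nodes: "pverts G = {0..n}"
    and conn: "Digraph_Component.connected (with_proj G)"
    and vl_pos: "\<And>j. j \<le> n \<Longrightarrow> 0 < vl j"
    and slack: "vl 0 = 1" "vu 0 = 1"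
begin

sublocale G: pair_graph G by (fact graph)

abbreviation "BIM \<equiv> bim_feasible n G y vl vu sl su"
abbreviation "OC \<equiv> oper_constraints n G y vl vu sl su"

section \<open>Graphs on the buses and their partial matrices\<close>

definition pmat_of :: "nat pair_pre_digraph \<Rightarrow> complex vec \<Rightarrow> pmat" where
  "pmat_of H V = restrict (\<lambda>(j, k). V $ j * cnj (V $ k)) (pm_index H)"

text \<open>Covers both \<open>G\<close> itself and its chordal extensions, so that factorization
  and bijection are treated once for both.\<close>

definition supergraph :: "nat pair_pre_digraph \<Rightarrow> bool" where
  "supergraph H \<longleftrightarrow> pair_graph H \<and> pverts H = {0..n} \<and> parcs G \<subseteq> parcs H"

lemma supergraph_G: "supergraph G"
  by (simp add: supergraph_def graph nodes)

lemma supergraph_pm_index: "supergraph H \<Longrightarrow> pm_index G \<subseteq> pm_index H"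
  by (auto simp: supergraph_def pm_index_def nodes)

lemma diag_pm_index: "supergraph H \<Longrightarrow> j \<le> n \<Longrightarrow> (j, j) \<in> pm_index H"
  by (auto simp: supergraph_def pm_index_def)

lemma arc_nodes: "supergraph H \<Longrightarrow> (j, k) \<in> parcs H \<Longrightarrow> j \<le> n \<and> k \<le> n"
  unfolding supergraph_def
  by (metis atLeastAtMost_iff pair_graph_def pair_digraph_def pair_fin_digraph_def
      pair_wf_digraph.wellformed')

lemma arc_sym: "supergraph H \<Longrightarrow> (j, k) \<in> parcs H \<Longrightarrow> (k, j) \<in> parcs H"
  unfolding supergraph_def
  by (metis pair_graph_def pair_pseudo_graph_def pair_sym_digraph.arcs_symmetric)

lemma walk_to_slack: "j \<le> n \<Longrightarrow> \<exists>p. G.awalk j p 0"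
proof -
  assume j: "j \<le> n"
  \<comment> \<open>In a symmetric digraph connectedness already gives directed walks between any
    two nodes.\<close>
  have "strongly_connected (with_proj G)"
    using G.sym_arcs conn by (rule G.symmetric_connected_imp_strongly_connected)
  then have "j \<rightarrow>\<^sup>*\<^bsub>with_proj G\<^esub> 0"
    using j by (auto simp: strongly_connected_def nodes)
  then show ?thesis by (simp add: G.reachable_awalk)
qed

section \<open>Voltages and the operational constraints\<close>

lemma bim_nonzero:
  assumes "V \<in> BIM" "j \<le> n"
  shows "V $ j \<noteq> 0"
proof
  assume "V $ j = 0"
  then have "vl j \<le> 0" using assms by (force simp: bim_feasible_def)
  with vl_pos[OF assms(2)] show False by simp
qed

text \<open>The value \<open>V $ 0 = 1\<close> starts an induction along a walk to the slack bus:
  where the voltages agree at the next node, the nonzero conjugate factor there cancels from the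
  product on the arc.\<close>

lemma bim_inj:
  assumes V: "V \<in> BIM" "V' \<in> BIM"
    and eq: "\<And>j k. (j, k) \<in> parcs G \<Longrightarrow> V $ j * cnj (V $ k) = V' $ j * cnj (V' $ k)"
  shows "V = V'"
proof -
  have "V $ j = V' $ j" if "G.awalk j p 0" for j p
    using that
  proof (induction p arbitrary: j)
    case Nil
    then show ?case using V by (simp add: G.awalk_Nil_iff bim_feasible_def)
  next
    case (Cons e p)
    then have e: "e = (j, snd e)" "(j, snd e) \<in> parcs G" "V $ snd e = V' $ snd e"
      by (auto simp: G.awalk_Cons_iff)
    then have "V $ snd e \<noteq> 0" using bim_nonzero[OF V(1)] arc_nodes[OF supergraph_G] by blast
    then show ?case using eq[OF e(2)] e(3) by simp
  qed
  then have "V $ j = V' $ j" if "j \<le> n" for j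
    using walk_to_slack[OF that] by blast
  then show ?thesis using V by (intro eq_vecI) (auto simp: bim_feasible_def)
qed

text \<open>Multiplied out, the power flow is linear in the products
  \<open>V $ j * cnj (V $ k)\<close>, and only those on nodes and arcs of \<open>G\<close> occur.
  One direction serves images of feasible voltages, the other voltages found by factoring.\<close>

lemma bim_iff:
  assumes V: "V \<in> carrier_vec (n + 1)" "V $ 0 = 1"
    and W: "\<And>j k. (j, k) \<in> pm_index G \<Longrightarrow> W (j, k) = V $ j * cnj (V $ k)"
  shows "V \<in> BIM \<longleftrightarrow> OC W"
proof -
  have d: "W (j, j) = complex_of_real ((cmod (V $ j))\<^sup>2)" if "j \<le> n" for j
    using W[OF diag_pm_index[OF supergraph_G that]] by (simp only: complex_norm_square)
  have term_eq: "cnj (y j k) * (V $ j) * (cnj (V $ j) - cnj (V $ k)) =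
      cnj (y j k) * (W (j, j) - W (j, k))"
    if "(j, k) \<in> parcs G" for j k
  proof -
    have "(j, k) \<in> pm_index G" using that by (simp add: pm_index_def)
    moreover have "(j, j) \<in> pm_index G"
      using arc_nodes[OF supergraph_G that] diag_pm_index[OF supergraph_G] by blast
    ultimately have "W (j, k) = V $ j * cnj (V $ k)" "W (j, j) = V $ j * cnj (V $ j)"
      using W by blast+
    then show ?thesis by (simp only: right_diff_distrib mult.assoc)
  qed
  have power: "(\<Sum>k | (j, k) \<in> parcs G. cnj (y j k) * (V $ j) * (cnj (V $ j) - cnj (V $ k))) =
      (\<Sum>k | (j, k) \<in> parcs G. cnj (y j k) * (W (j, j) - W (j, k)))" for j
    by (rule sum.cong[OF refl]) (rule term_eq, simp)
  \<comment> \<open>The diagonal entry is a squared modulus, hence real, so the zero bounds on its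
    imaginary part hold automatically.\<close>
  have "cbetween (ereal (vl j), 0) (W (j, j)) (ereal (vu j), 0) \<longleftrightarrow>
      vl j \<le> (cmod (V $ j))\<^sup>2 \<and> (cmod (V $ j))\<^sup>2 \<le> vu j" if "j \<in> {0..n}" for j
  proof -
    have "W (j, j) = complex_of_real ((cmod (V $ j))\<^sup>2)" using d that by simp
    then show ?thesis
      by (simp only: cbetween_def Re_complex_of_real Im_complex_of_real) (simp add: zero_ereal_def)
  qed
  moreover have "V \<in> BIM \<longleftrightarrow> (\<forall>j \<in> {0..n}.
      vl j \<le> (cmod (V $ j))\<^sup>2 \<and> (cmod (V $ j))\<^sup>2 \<le> vu j \<and>
      cbetween (sl j) (\<Sum>k | (j, k) \<in> parcs G. cnj (y j k) * (V $ j) * (cnj (V $ j) - cnj (V $ k)))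
        (su j))"
    unfolding bim_feasible_def using V by blast
  ultimately show ?thesis
    unfolding oper_constraints_def power by blast
qed

text \<open>The zero bounds on the imaginary part force a real entry, and the positive
  \<open>vl j\<close> makes it positive.\<close>

lemma OC_diag:
  assumes "OC W" "j \<le> n"
  shows "W (j, j) = complex_of_real (Re (W (j, j)))" "0 < Re (W (j, j))"
proof -
  have "cbetween (ereal (vl j), 0) (W (j, j)) (ereal (vu j), 0)"
    using assms unfolding oper_constraints_def by auto
  then have "Im (W (j, j)) = 0" "vl j \<le> Re (W (j, j))"
    by (auto simp: cbetween_def zero_ereal_def)
  then show "W (j, j) = complex_of_real (Re (W (j, j)))" "0 < Re (W (j, j))"
    using vl_pos[OF assms(2)] by (auto simp: complex_eq_iff)
qed

text \<open>The coinciding bounds at the slack bus pin this entry; it later gives the factors their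
  normalization \<open>V $ 0 = 1\<close>.\<close>

lemma OC_slack:
  assumes "OC W"
  shows "W (0, 0) = 1"
proof -
  have "cbetween (ereal (vl 0), 0) (W (0, 0)) (ereal (vu 0), 0)"
    using assms unfolding oper_constraints_def by auto
  then show ?thesis
    using slack by (auto simp: cbetween_def zero_ereal_def complex_eq_iff)
qed

text \<open>The common surjectivity argument for partial matrices. \<open>W\<close> lives on
  \<open>H\<close> while \<open>OC\<close> refers to a submatrix on \<open>G\<close>; hence the
  separate \<open>W'\<close>, tied to \<open>W\<close> by the diagonal. The edge minors fix the
  moduli, and \<open>H.gain_potential\<close> splits the phases.\<close>

lemma factorization:
  assumes H: "supergraph H"
    and herm: "\<And>j k. (j, k) \<in> parcs H \<Longrightarrow> W (k, j) = cnj (W (j, k))"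
    and OC: "OC W'" and diag: "\<And>j. j \<le> n \<Longrightarrow> W (j, j) = W' (j, j)"
    and minor: "\<And>j k. (j, k) \<in> parcs H \<Longrightarrow> W (j, k) * W (k, j) = W (j, j) * W (k, k)"
    and cyc: "\<And>c. ucycle H c \<Longrightarrow> \<nexists>e. is_chord H c e \<Longrightarrow> prod_list (map (\<lambda>e. sgn (W e)) c) = 1"
  shows "\<exists>V\<in>carrier_vec (n + 1). V $ 0 = 1 \<and>
    (\<forall>j k. (j, k) \<in> pm_index H \<longrightarrow> W (j, k) = V $ j * cnj (V $ k))"
proof -
  interpret H: pair_graph H using H by (simp add: supergraph_def)
  define r where "r j = Re (W (j, j))" for j
  have r: "W (j, j) = complex_of_real (r j)" "0 < r j" if "j \<le> n" for j
    using OC_diag[OF OC that] diag[OF that] by (simp_all add: r_def)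
  have norm: "cmod (W (j, k)) = sqrt (r j) * sqrt (r k)" if "(j, k) \<in> parcs H" for j k
  proof -
    have jk: "j \<le> n" "k \<le> n" using arc_nodes[OF H that] by auto
    have "complex_of_real ((cmod (W (j, k)))\<^sup>2) = W (j, k) * W (k, j)"
      unfolding herm[OF that] by (rule complex_norm_square)
    also have "\<dots> = complex_of_real (r j * r k)"
      using minor[OF that] r(1) jk by simp
    finally have "(cmod (W (j, k)))\<^sup>2 = r j * r k" by (simp only: of_real_eq_iff)
    then show ?thesis by (metis norm_ge_zero real_sqrt_mult real_sqrt_unique)
  qed
  have walks: "\<exists>p. H.awalk j p 0" if j: "j \<in> pverts H" for j
  proof -
    have vH: "pverts H = {0..n}" and sub: "parcs G \<subseteq> parcs H" using H by (auto simp: supergraph_def)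
    obtain p where "G.awalk j p 0" using walk_to_slack j vH by auto
    then have "H.awalk j p 0"
      using sub j unfolding G.awalk_def H.awalk_def by auto
    then show ?thesis by blast
  qed
  obtain \<phi> where \<phi>: "\<phi> 0 = 1" "\<And>j. j \<in> pverts H \<Longrightarrow> cmod (\<phi> j) = 1"
    "\<And>j k. (j, k) \<in> parcs H \<Longrightarrow> sgn (W (j, k)) = \<phi> j * cnj (\<phi> k)"
  proof (rule H.gain_potential[of "\<lambda>e. sgn (W e)" 0])
    fix e assume "e \<in> parcs H"
    then have "cmod (W e) \<noteq> 0"
      using norm[of "fst e" "snd e"] r arc_nodes[OF H, of "fst e" "snd e"]
      by (metis mult_eq_0_iff less_irrefl prod.collapse real_sqrt_eq_zero_cancel_iff)
    then show "cmod (sgn (W e)) = 1" by (simp add: norm_sgn)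
  next
    show "0 \<in> pverts H" using H by (simp add: supergraph_def)
  qed (use herm cyc walks in \<open>auto simp: sgn_cnj\<close>)
  \<comment> \<open>The modulus comes from the diagonal of \<open>W\<close>, the phase from the
    potential.\<close>
  define V where "V = vec (n + 1) (\<lambda>j. complex_of_real (sqrt (r j)) * \<phi> j)"
  have "r 0 = 1" using OC_slack[OF OC] diag[of 0] by (simp add: r_def)
  then have "V $ 0 = 1" by (simp add: V_def \<phi>)
  moreover have "W (j, k) = V $ j * cnj (V $ k)" if jk: "(j, k) \<in> pm_index H" for j k
  proof (cases "j = k")
    case True
    then have "j \<le> n" using jk arc_nodes[OF H] H by (auto simp: pm_index_def supergraph_def)
    then have "V $ j * cnj (V $ j) = complex_of_real ((cmod (complex_of_real (sqrt (r j)) * \<phi> j))\<^sup>2)"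
      by (simp only: complex_norm_square) (simp add: V_def)
    also have "\<dots> = complex_of_real (r j)"
      using \<phi>(2)[of j] \<open>j \<le> n\<close> H r(2)[of j] by (simp add: norm_mult supergraph_def)
    finally show ?thesis using r True \<open>j \<le> n\<close> by simp
  next
    case False
    then have e: "(j, k) \<in> parcs H" using jk by (auto simp: pm_index_def)
    have "W (j, k) = complex_of_real (cmod (W (j, k))) * sgn (W (j, k))"
      by (cases "W (j, k) = 0") (auto simp: sgn_eq)
    also have "\<dots> = V $ j * cnj (V $ k)"
      using norm[OF e] \<phi>(3)[OF e] arc_nodes[OF H e] by (simp add: V_def mult_ac)
    finally show ?thesis .
  qed
  moreover have "V \<in> carrier_vec (n + 1)" by (simp add: V_def)
  ultimately show ?thesis by blast
qed

text \<open>Leaves to each set of partial matrices only its own conditions: \<open>bim_inj\<close>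
  gives injectivity, \<open>bim_iff\<close> transfers the operational constraints, and a factor of
  \<open>W\<close> is its preimage.\<close>

lemma bim_eqpoll:
  assumes H: "supergraph H"
    and into: "\<And>V. V \<in> BIM \<Longrightarrow> OC (submat_on G (pmat_of H V)) \<Longrightarrow> pmat_of H V \<in> S"
    and onto: "\<And>W. W \<in> S \<Longrightarrow> W \<in> partial_mats H \<and> OC (submat_on G W) \<and>
      (\<exists>V\<in>carrier_vec (n + 1). V $ 0 = 1 \<and>
        (\<forall>j k. (j, k) \<in> pm_index H \<longrightarrow> W (j, k) = V $ j * cnj (V $ k)))"
  shows "BIM \<approx> S"
proof -
  have "inj_on (pmat_of H) BIM"
  proof (rule inj_onI)
    fix V V' assume V: "V \<in> BIM" "V' \<in> BIM" and eq: "pmat_of H V = pmat_of H V'"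
    show "V = V'"
    proof (rule bim_inj[OF V])
      fix j k assume "(j, k) \<in> parcs G"
      then have "(j, k) \<in> pm_index H" using H by (auto simp: supergraph_def pm_index_def)
      then show "V $ j * cnj (V $ k) = V' $ j * cnj (V' $ k)"
        using fun_cong[OF eq, of "(j, k)"] by (simp add: pmat_of_def)
    qed
  qed
  moreover have "pmat_of H ` BIM = S"
  proof (intro equalityI subsetI)
    fix W assume "W \<in> pmat_of H ` BIM"
    then obtain V where V: "V \<in> BIM" "W = pmat_of H V" by auto
    then have "V \<in> carrier_vec (n + 1)" "V $ 0 = 1" by (auto simp: bim_feasible_def)
    moreover have "submat_on G (pmat_of H V) (j, k) = V $ j * cnj (V $ k)"
      if "(j, k) \<in> pm_index G" for j k
      using that supergraph_pm_index[OF H] by (auto simp: submat_on_def pmat_of_def)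
    ultimately have "OC (submat_on G (pmat_of H V))"
      using bim_iff V(1) by blast
    then show "W \<in> S" using into V by blast
  next
    fix W assume "W \<in> S"
    from onto[OF this] obtain V where V: "V \<in> carrier_vec (n + 1)" "V $ 0 = 1"
      and W: "W \<in> partial_mats H" "OC (submat_on G W)"
        "\<And>j k. (j, k) \<in> pm_index H \<Longrightarrow> W (j, k) = V $ j * cnj (V $ k)"
      by blast
    have "submat_on G W (j, k) = V $ j * cnj (V $ k)" if "(j, k) \<in> pm_index G" for j k
      using that W(3) supergraph_pm_index[OF H] by (auto simp: submat_on_def)
    then have "V \<in> BIM" using bim_iff[OF V, of "submat_on G W"] W(2) by blast
    \<comment> \<open>Both sides are undefined off the index set of \<open>H\<close>, so agreement
      on that set is equality.\<close>
    moreover have "W = pmat_of H V"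
      using W(1,3) unfolding partial_mats_def pmat_of_def
      by (intro extensionalityI[of _ "pm_index H"]) auto
    ultimately show "W \<in> pmat_of H ` BIM" by blast
  qed
  ultimately show ?thesis by (auto simp: eqpoll_def bij_betw_def)
qed

text \<open>Stated for any nonempty set of pairwise adjacent nodes, so that it serves the cliques of
  a chordal extension as well as the two ends of an edge of \<open>G\<close>. On such a set every
  entry is present and the submatrix is an outer product.\<close>

lemma pmat_of_clique:
  assumes "supergraph H" "V \<in> BIM" "q \<noteq> {}" "q \<subseteq> {0..n}"
    and "\<And>j k. j \<in> q \<Longrightarrow> k \<in> q \<Longrightarrow> j \<noteq> k \<Longrightarrow> (j, k) \<in> parcs H"
  shows "psd_mat (principal_submat (pmat_of H V) q)" "mat_rank (principal_submat (pmat_of H V) q) = 1"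
proof -
  have "pmat_of H V (j, k) = V $ j * cnj (V $ k)" if "j \<in> q" "k \<in> q" for j k
    using that assms by (cases "j = k") (auto simp: pmat_of_def pm_index_def supergraph_def)
  moreover have "finite q" using assms by (auto intro: finite_subset)
  moreover have "V $ j \<noteq> 0" if "j \<in> q" for j using that assms bim_nonzero by auto
  ultimately show "psd_mat (principal_submat (pmat_of H V) q)"
    "mat_rank (principal_submat (pmat_of H V) q) = 1"
    using principal_submat_outer_psd_rank_1[of q "\<lambda>j. V $ j" "pmat_of H V"] assms(3) by auto
qed

lemma pmat_of_hermitian: "supergraph H \<Longrightarrow> pm_hermitian H (pmat_of H V)"
proof -
  assume H: "supergraph H"
  have "(k, j) \<in> pm_index H" if "(j, k) \<in> pm_index H" for j k
    using that arc_sym[OF H, of j k] by (auto simp: pm_index_def)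
  then show ?thesis by (auto simp: pm_hermitian_def pmat_of_def)
qed

section \<open>The three bijections\<close>

lemma bim_eqpoll_full: "BIM \<approx> full_feasible n G y vl vu sl su"
proof -
  let ?f = "\<lambda>V. outer_mat (n + 1) (\<lambda>j. V $ j)"
  have entry: "full_submat_on G W (j, k) = W $$ (j, k)" if "(j, k) \<in> pm_index G" for W j k
    using that by (simp add: full_submat_on_def)
  have small: "j < n + 1 \<and> k < n + 1" if "(j, k) \<in> pm_index G" for j k
    using that arc_nodes[OF supergraph_G, of j k] nodes by (auto simp: pm_index_def)
  have "inj_on ?f BIM"
  proof (rule inj_onI)
    fix V V' assume V: "V \<in> BIM" "V' \<in> BIM" and eq: "?f V = ?f V'"
    show "V = V'"
    proof (rule bim_inj[OF V])
      fix j k assume "(j, k) \<in> parcs G"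
      then have "j < n + 1 \<and> k < n + 1" using small by (auto simp: pm_index_def)
      then show "V $ j * cnj (V $ k) = V' $ j * cnj (V' $ k)"
        using arg_cong[OF eq, of "\<lambda>A. A $$ (j, k)"] by simp
    qed
  qed
  moreover have "?f ` BIM = full_feasible n G y vl vu sl su"
  proof (intro equalityI subsetI)
    fix W assume "W \<in> ?f ` BIM"
    then obtain V where V: "V \<in> BIM" "W = ?f V" by auto
    then have V': "V \<in> carrier_vec (n + 1)" "V $ 0 = 1" by (auto simp: bim_feasible_def)
    have "full_submat_on G W (j, k) = V $ j * cnj (V $ k)" if "(j, k) \<in> pm_index G" for j k
      using small[OF that] entry[OF that] by (simp add: V(2))
    then have "OC (full_submat_on G W)"
      using bim_iff[OF V', of "full_submat_on G W"] V(1) by blast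
    moreover have "psd_mat W" by (simp add: V(2) psd_outer_mat)
    moreover have "mat_rank W = 1"
      unfolding V(2) using V' by (simp add: rank_outer_mat[of 0])
    ultimately show "W \<in> full_feasible n G y vl vu sl su"
      by (simp add: full_feasible_def psd_mat_def V(2))
  next
    fix W assume "W \<in> full_feasible n G y vl vu sl su"
    then have W: "W \<in> carrier_mat (n + 1) (n + 1)" "hermitian_mat W" "OC (full_submat_on G W)"
      "mat_rank W = 1"
      by (auto simp: full_feasible_def)
    \<comment> \<open>Since the slack voltage is one, column \<open>0\<close> of the outer product
      of \<open>V\<close> is \<open>V\<close> itself, which leaves only this candidate.\<close>
    define V where "V = vec (n + 1) (\<lambda>j. W $$ (j, 0))"
    have W0: "W $$ (0, 0) = 1"
      using OC_slack[OF W(3)] entry[OF diag_pm_index[OF supergraph_G, of 0]] by simp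
    have fac: "W $$ (j, k) = V $ j * cnj (V $ k)" if "j < n + 1" "k < n + 1" for j k
    proof -
      \<comment> \<open>The minor on rows \<open>j\<close>, \<open>0\<close> and columns
        \<open>k\<close>, \<open>0\<close> expresses every entry through column \<open>0\<close> and
        row \<open>0\<close>.\<close>
      have "W $$ (j, k) * W $$ (0, 0) = W $$ (j, 0) * W $$ (0, k)"
        using rank_1_minor[OF W(1,4), of j 0 k 0] that by simp
      moreover have "W $$ (0, k) = cnj (W $$ (k, 0))"
        using iffD1[OF hermitian_mat_iff[OF W(1)] W(2), rule_format, of k 0] that(2) by simp
      ultimately show ?thesis using that W0 by (simp add: V_def)
    qed
    have V: "V \<in> carrier_vec (n + 1)" "V $ 0 = 1" by (simp_all add: V_def W0)
    have "full_submat_on G W (j, k) = V $ j * cnj (V $ k)" if "(j, k) \<in> pm_index G" for j k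
      using small[OF that] entry[OF that] fac by simp
    then have "V \<in> BIM" using bim_iff[OF V, of "full_submat_on G W"] W(3) by blast
    moreover have "W = ?f V"
      using W(1) fac by (intro eq_matI) (auto simp: outer_mat_def)
    ultimately show "W \<in> ?f ` BIM" by blast
  qed
  ultimately show ?thesis by (auto simp: eqpoll_def bij_betw_def)
qed

lemma bim_eqpoll_chordal:
  assumes F: "chordal_extension F G"
  shows "BIM \<approx> chordal_feasible n G F y vl vu sl su"
proof (rule bim_eqpoll)
  show H: "supergraph F" using F nodes by (simp add: chordal_extension_def supergraph_def)
  have vF: "pverts F = {0..n}" using H by (simp add: supergraph_def)
  fix V assume V: "V \<in> BIM" "OC (submat_on G (pmat_of F V))"
  have "pm_psd F (pmat_of F V)" "pm_rank1 F (pmat_of F V)"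
    unfolding pm_psd_def pm_rank1_def
    using pmat_of_hermitian[OF H] pmat_of_clique[OF H V(1)] vF by (auto simp: clique_def)
  then show "pmat_of F V \<in> chordal_feasible n G F y vl vu sl su"
    using V(2) by (auto simp: chordal_feasible_def partial_mats_def pmat_of_def)
next
  have H: "supergraph F" using F nodes by (simp add: chordal_extension_def supergraph_def)
  interpret F: pair_graph F using H by (simp add: supergraph_def)
  have vF: "pverts F = {0..n}" using H by (simp add: supergraph_def)
  fix W assume "W \<in> chordal_feasible n G F y vl vu sl su"
  then have W: "W \<in> partial_mats F" "OC (submat_on G W)"
    and herm: "pm_hermitian F W" and rank: "pm_rank1 F W"
    by (auto simp: chordal_feasible_def pm_psd_def)
  have diag: "W (j, j) = submat_on G W (j, j)" if "j \<le> n" for j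
    using diag_pm_index[OF supergraph_G that] by (simp add: submat_on_def)
  have minor: "W (i, k) * W (j, l) = W (i, l) * W (j, k)"
    if "clique F q" "i \<in> q" "j \<in> q" "k \<in> q" "l \<in> q" for q i j k l
  proof (rule principal_submat_rank_1_minor)
    show "finite q" using that(1) vF by (metis clique_def finite_atLeastAtMost finite_subset)
    show "mat_rank (principal_submat W q) = 1" using that(1) rank by (simp add: pm_rank1_def)
  qed (use that in auto)
  \<comment> \<open>The two ends of an edge form a clique, so this is the determinant of its
    submatrix.\<close>
  have edge: "W (j, k) * W (k, j) = W (j, j) * W (k, k)" if "(j, k) \<in> parcs F" for j k
    using that arc_nodes[OF H that] arc_sym[OF H that] vF
    by (intro minor[of "{j, k}"]) (auto simp: clique_def)
  have "\<exists>V\<in>carrier_vec (n + 1). V $ 0 = 1 \<and>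
      (\<forall>j k. (j, k) \<in> pm_index F \<longrightarrow> W (j, k) = V $ j * cnj (V $ k))"
  proof (rule factorization[OF H _ W(2) diag edge])
    show "W (k, j) = cnj (W (j, k))" if "(j, k) \<in> parcs F" for j k
      using herm that by (auto simp: pm_hermitian_def pm_index_def)
  next
    fix c assume c: "ucycle F c" "\<nexists>e. is_chord F c e"
    then have "length c = 3" using F by (auto simp: chordal_extension_def chordal_def)
    then obtain e1 e2 e3 where ce: "c = [e1, e2, e3]"
      by (auto simp: length_Suc_conv numeral_3_eq_3)
    then obtain u where "F.awalk u c u" using c(1) by (auto simp: ucycle_def F.cycle_def)
    then obtain i j k where cyc: "c = [(i, j), (j, k), (k, i)]"
      and arcs: "(i, j) \<in> parcs F" "(j, k) \<in> parcs F" "(k, i) \<in> parcs F"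
      unfolding ce by (cases e1; cases e2; cases e3) (auto simp: F.awalk_simps)
    have n: "i \<le> n" "j \<le> n" "k \<le> n" using arcs arc_nodes[OF H] by blast+
    have "clique F {i, j, k}"
      using arcs arcs[THEN arc_sym[OF H]] n vF by (auto simp: clique_def)
    \<comment> \<open>The minor on rows \<open>i\<close>, \<open>j\<close> and columns
      \<open>j\<close>, \<open>k\<close> of the triangle. Multiplied by \<open>W (k, i)\<close> and
      combined with the minor of the edge between \<open>k\<close> and \<open>i\<close>, it turns
      the product around the cycle into a product of positive diagonal entries, whose phase is
      one.\<close>
    then have "W (i, j) * W (j, k) = W (i, k) * W (j, j)" by (rule minor) auto
    then have "W (i, j) * W (j, k) * W (k, i) = W (i, i) * W (j, j) * W (k, k)"
      using edge[OF arcs(3)] by (simp add: mult_ac)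
    moreover have "sgn (W (l, l)) = 1" if "l \<le> n" for l
      using OC_diag[OF W(2) that] diag[OF that]
      by (metis of_real_1 sgn_of_real sgn_pos)
    ultimately have "sgn (W (i, j)) * sgn (W (j, k)) * sgn (W (k, i)) = 1"
      using n by (metis mult_1 sgn_mult)
    then show "prod_list (map (\<lambda>e. sgn (W e)) c) = 1" by (simp add: cyc mult.assoc)
  qed
  with W show "W \<in> partial_mats F \<and> OC (submat_on G W) \<and>
      (\<exists>V\<in>carrier_vec (n + 1). V $ 0 = 1 \<and>
        (\<forall>j k. (j, k) \<in> pm_index F \<longrightarrow> W (j, k) = V $ j * cnj (V $ k)))"
    by blast
qed

lemma bim_eqpoll_network: "BIM \<approx> network_feasible n G y vl vu sl su"
proof (rule bim_eqpoll[OF supergraph_G])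
  \<comment> \<open>\<open>bim_eqpoll\<close> speaks of the submatrix on \<open>G\<close>, which for
    a partial matrix on \<open>G\<close> is the matrix itself.\<close>
  have sub: "submat_on G W = W" if "W \<in> partial_mats G" for W
    using that by (simp add: submat_on_def partial_mats_def extensional_restrict)
  {
    fix V assume V: "V \<in> BIM" "OC (submat_on G (pmat_of G V))"
    have pm: "pmat_of G V \<in> partial_mats G" by (simp add: partial_mats_def pmat_of_def)
    have entry: "pmat_of G V e = V $ fst e * cnj (V $ snd e)" if "e \<in> parcs G" for e
      using that by (cases e) (simp add: pmat_of_def pm_index_def)
    have nz: "V $ j \<noteq> 0" if "j \<in> pverts G" for j
      using bim_nonzero[OF V(1)] that nodes by simp
    have unit: "sgn (V $ j) * cnj (sgn (V $ j)) = 1" if "j \<in> pverts G" for j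
      using nz[OF that] by (simp add: complex_norm_square[symmetric] norm_sgn)
    have "cycle_condition G (pmat_of G V)"
      unfolding cycle_condition_def
    proof (intro allI impI)
      fix c assume "ucycle G c"
      then obtain u where c: "G.awalk u c u" by (auto simp: ucycle_def G.cycle_def)
      then have arcs: "e \<in> parcs G" if "e \<in> set c" for e using that by auto
      have "u \<in> pverts G" using c by auto
      \<comment> \<open>The phases on the arcs are quotients of node phases and telescope around the
        cycle.\<close>
      have "prod_list (map (\<lambda>e. sgn (pmat_of G V e)) c) =
          prod_list (map (\<lambda>e. sgn (V $ fst e) * cnj (sgn (V $ snd e))) c)"
        by (intro arg_cong[of _ _ prod_list] map_cong refl) (simp add: entry arcs sgn_mult sgn_cnj)
      also have "\<dots> = sgn (V $ u) * cnj (sgn (V $ u))"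
        using unit c by (rule G.prod_telescope)
      also have "\<dots> = 1" using unit[OF \<open>u \<in> pverts G\<close>] .
      finally show "[(\<Sum>e\<leftarrow>c. Arg (pmat_of G V e)) = 0] (rmod (2 * pi))"
        using prod_list_sgn_eq_1_iff[of c "pmat_of G V"] arcs nz G.wellformed
        by (auto simp: entry)
    qed
    moreover have "psd_mat (principal_submat (pmat_of G V) {j, k})"
      "mat_rank (principal_submat (pmat_of G V) {j, k}) = 1" if "(j, k) \<in> parcs G" for j k
      using that arc_nodes[OF supergraph_G that] arc_sym[OF supergraph_G that]
      by (intro pmat_of_clique[OF supergraph_G V(1)]; auto)+
    ultimately show "pmat_of G V \<in> network_feasible n G y vl vu sl su"
      using V(2) pm sub[OF pm] pmat_of_hermitian[OF supergraph_G]
      by (auto simp: network_feasible_def)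
  next
    fix W assume "W \<in> network_feasible n G y vl vu sl su"
    then have W: "W \<in> partial_mats G" "pm_hermitian G W" "OC W" "cycle_condition G W"
      and rank: "\<And>j k. (j, k) \<in> parcs G \<Longrightarrow> mat_rank (principal_submat W {j, k}) = 1"
      by (auto simp: network_feasible_def)
    have minor: "W (j, k) * W (k, j) = W (j, j) * W (k, k)" if "(j, k) \<in> parcs G" for j k
      using rank[OF that] by (intro principal_submat_rank_1_minor[of "{j, k}"]) auto
    have "\<exists>V\<in>carrier_vec (n + 1). V $ 0 = 1 \<and>
        (\<forall>j k. (j, k) \<in> pm_index G \<longrightarrow> W (j, k) = V $ j * cnj (V $ k))"
    proof (rule factorization[OF supergraph_G, of W W])
      show "W (k, j) = cnj (W (j, k))" if "(j, k) \<in> parcs G" for j k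
        using W(2) that by (auto simp: pm_hermitian_def pm_index_def)
    next
      fix c assume "ucycle G c"
      then have "set c \<subseteq> parcs G" by (auto simp: ucycle_def G.cycle_def)
      \<comment> \<open>The edge minor equates the product of \<open>W (j, k)\<close> and
        \<open>W (k, j)\<close> with a product of positive diagonal entries. Nonzero entries are
        what lets argument sums be read as products of phases.\<close>
      moreover have "W e \<noteq> 0" if "e \<in> parcs G" for e
        using minor[of "fst e" "snd e"] that OC_diag(2)[OF W(3)]
          arc_nodes[OF supergraph_G, of "fst e" "snd e"]
        by (metis less_irrefl mult_eq_0_iff prod.collapse zero_complex.sel(1))
      ultimately show "prod_list (map (\<lambda>e. sgn (W e)) c) = 1"
        using W(4) \<open>ucycle G c\<close> prod_list_sgn_eq_1_iff[of c W]
        by (auto simp: cycle_condition_def)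
    qed (use W(3) minor in auto)
    with W sub[OF W(1)] show "W \<in> partial_mats G \<and> OC (submat_on G W) \<and>
        (\<exists>V\<in>carrier_vec (n + 1). V $ 0 = 1 \<and>
          (\<forall>j k. (j, k) \<in> pm_index G \<longrightarrow> W (j, k) = V $ j * cnj (V $ k)))"
      by simp
  }
qed

end

theorem theorem4:
  fixes n :: nat
    and G F :: "nat pair_pre_digraph"
    and y :: "nat \<Rightarrow> nat \<Rightarrow> complex"
    and vl vu :: "nat \<Rightarrow> real"
    and sl su :: "nat \<Rightarrow> cbound"
  assumes graph: "pair_graph G"
    and nodes: "pverts G = {0..n}"
    and conn: "Digraph_Component.connected (with_proj G)"
    and y_nonzero: "\<And>j k. (j, k) \<in> parcs G \<Longrightarrow> y j k \<noteq> 0"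
    and y_sym: "\<And>j k. (j, k) \<in> parcs G \<Longrightarrow> y j k = y k j"
    and v_bounds: "\<And>j. j \<in> {0..n} \<Longrightarrow> 0 < vl j \<and> vl j \<le> vu j"
    and slack_v: "vl 0 = 1" "vu 0 = 1"
    and slack_s: "sl 0 = (-\<infinity>, -\<infinity>)" "su 0 = (\<infinity>, \<infinity>)"
    and ext: "chordal_extension F G"
  shows "bim_feasible n G y vl vu sl su \<approx> full_feasible n G y vl vu sl su \<and>
         full_feasible n G y vl vu sl su \<approx> chordal_feasible n G F y vl vu sl su \<and>
         chordal_feasible n G F y vl vu sl su \<approx> network_feasible n G y vl vu sl su"
proof -
  interpret opf n G y vl vu sl su
    using graph nodes conn v_bounds slack_v by (intro opf.intro) auto
  have "BIM \<approx> full_feasible n G y vl vu sl su" "BIM \<approx> chordal_feasible n G F y vl vu sl su"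
    "BIM \<approx> network_feasible n G y vl vu sl su"
    using bim_eqpoll_full bim_eqpoll_chordal[OF ext] bim_eqpoll_network by auto
  then show ?thesis by (meson eqpoll_sym eqpoll_trans)
qed

end
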